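(* Let $\tau$ be the random ordering in which $\tau(1),\tau(2),\dots$ are i.i.d. uniform on $\{1,\dots,T\}$. For every $S=\{(X_m,y_m)\}_{m=1}^T\in\mathcal{S}_T$ with $r_{\mathrm{avg}}=\frac1T\sum_{m=1}^T\operatorname{rank}(X_m)$ and every $k\ge2$, $$\mathbb{E}_\tau\big[F_{\tau,S}(k)\big]\le\frac{9(d-r_{\mathrm{avg}})}{k}.$$
   Context: Let $d\ge 1$, $T\ge1$. A task is a pair $(X_m,y_m)$ with $X_m\in\mathbb{R}^{n_m\times d}$, $y_m\in\mathbb{R}^{n_m}$ and $\operatorname{rank}(X_m)<d$. $\mathcal{S}_T$ denotes the set of collections $S=\{(X_m,y_m)\}_{m=1}^T$ of $T$ tasks such that $\|X_m\|\le 1$ (spectral norm) for all $m$ and there exists $w\in\mathbb{R}^d$ with $\|w\|\le 1$ and $y_m=X_mw$ for all $m$. Given $S$ and an ordering $\tau:\mathbb{N}^+\to\{1,\dots,T\}$, the iterates are $w_0=0$ and $w_t=w_{t-1}+X_{\tau(t)}^+(y_{\tau(t)}-X_{\tau(t)}w_{t-1})$, with $A^+$ the Moore–Penrose pseudoinverse. The forgetting at iteration $k$ is $F_{\tau,S}(k)=\frac1k\sum_{t=1}^k\|X_{\tau(t)}w_k-y_{\tau(t)}\|^2$. *)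

theory Defs
  imports "Jordan_Normal_Form.DL_Rank" "HOL-Probability.Product_PMF"
begin

definition vnorm :: "real Matrix.vec \<Rightarrow> real" where
  "vnorm v = sqrt (scalar_prod v v)"

definition spec_norm :: "real mat \<Rightarrow> real" where
  "spec_norm A = Sup {vnorm (A *\<^sub>v v) | v. v \<in> carrier_vec (dim_col A) \<and> vnorm v \<le> 1}"

definition mrank :: "real mat \<Rightarrow> nat" where
  "mrank A = vec_space.rank (dim_row A) A"

(* Moore-Penrose pseudoinverse: the unique matrix satisfying the four Penrose equations *)
definition pinv :: "real mat \<Rightarrow> real mat" where
  "pinv A = (THE B. B \<in> carrier_mat (dim_col A) (dim_row A) \<and>
      A * B * A = A \<and> B * A * B = B \<and>
      transpose_mat (A * B) = A * B \<and> transpose_mat (B * A) = B * A)"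

definition in_S :: "nat \<Rightarrow> nat \<Rightarrow> (nat \<Rightarrow> real mat) \<Rightarrow> (nat \<Rightarrow> real Matrix.vec) \<Rightarrow> bool" where
  "in_S d T X y \<longleftrightarrow>
     (\<forall>m\<in>{1..T}. dim_col (X m) = d \<and> y m \<in> carrier_vec (dim_row (X m))
                 \<and> mrank (X m) < d \<and> spec_norm (X m) \<le> 1) \<and>
     (\<exists>w\<in>carrier_vec d. vnorm w \<le> 1 \<and> (\<forall>m\<in>{1..T}. y m = X m *\<^sub>v w))"

fun iterate :: "nat \<Rightarrow> (nat \<Rightarrow> real mat) \<Rightarrow> (nat \<Rightarrow> real Matrix.vec) \<Rightarrow> (nat \<Rightarrow> nat) \<Rightarrow> nat \<Rightarrow> real Matrix.vec" where
  "iterate d X y tau 0 = 0\<^sub>v d"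
| "iterate d X y tau (Suc t) =
     iterate d X y tau t + pinv (X (tau (Suc t))) *\<^sub>v
        (y (tau (Suc t)) - X (tau (Suc t)) *\<^sub>v iterate d X y tau t)"

definition forgetting :: "nat \<Rightarrow> (nat \<Rightarrow> real mat) \<Rightarrow> (nat \<Rightarrow> real Matrix.vec) \<Rightarrow> (nat \<Rightarrow> nat) \<Rightarrow> nat \<Rightarrow> real" where
  "forgetting d X y tau k =
     (1 / real k) * (\<Sum>t=1..k. (vnorm (X (tau t) *\<^sub>v iterate d X y tau k - y (tau t)))\<^sup>2)"

(* law of (tau(1),...,tau(k)) with tau(i) i.i.d. uniform on {1..T}; coordinates outside {1..k} fixed to 1 *)
definition ordering_law :: "nat \<Rightarrow> nat \<Rightarrow> (nat \<Rightarrow> nat) pmf" where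
  "ordering_law T k = Pi_pmf {1..k} 1 (\<lambda>_. pmf_of_set {1..T})"

end

theory Submission
  imports Defs
begin

text \<open>
Let \<open>R\<^sub>m = X\<^sub>m\<^sup>+ X\<^sub>m\<close> and \<open>P\<^sub>m = 1 - R\<^sub>m\<close>, an orthogonal projection of squared Frobenius norm
\<open>d - rank X\<^sub>m\<close>. With a common solution \<open>w\<close>, the error after \<open>k\<close> steps is
\<open>P\<^bsub>\<tau>(k)\<^esub> \<dots> P\<^bsub>\<tau>(1)\<^esub> w\<close>, so the forgetting is at most the mean over \<open>t \<le> k\<close> of
\<open>\<parallel>R\<^bsub>\<tau>(t)\<^esub> P\<^bsub>\<tau>(k)\<^esub> \<dots> P\<^bsub>\<tau>(1)\<^esub>\<parallel>\<^sup>2\<close> in the Frobenius norm.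

For a fresh index \<open>x\<close>, the expectation \<open>e\<^sub>n\<close> of \<open>\<parallel>R\<^sub>x P\<^bsub>\<tau>(n)\<^esub> \<dots> P\<^bsub>\<tau>(1)\<^esub>\<parallel>\<^sup>2\<close> equals \<open>a\<^sub>n - a\<^bsub>n+1\<^esub>\<close>,
where \<open>a\<^sub>n\<close> is the expected squared norm of a product of \<open>n\<close> projections, and it does not increase
with \<open>n\<close> because multiplication by a projection from the right is a contraction. Telescoping gives
\<open>e\<^sub>n \<le> a\<^sub>1 / n\<close> with \<open>a\<^sub>1 = d - r\<^bsub>avg\<^esub>\<close>.

For \<open>x = \<tau>(t)\<close> with \<open>t < k\<close>, split the product as \<open>u P\<^sub>x v\<close> and write
\<open>R\<^sub>x u P\<^sub>x v = R\<^sub>x u v - R\<^sub>x u R\<^sub>x v\<close>. The first term contributes at most \<open>e\<^bsub>k-1\<^esub>\<close>; the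
second is bounded both by \<open>\<parallel>R\<^sub>x u\<parallel>\<close> and by \<open>\<parallel>R\<^sub>x v\<parallel>\<close>, hence contributes at most
\<open>2 a\<^sub>1 / (k-1)\<close> since one of \<open>u\<close>, \<open>v\<close> has at least \<open>(k-1)/2\<close> factors. The term
\<open>t = k\<close> vanishes, and the total is at most \<open>6 a\<^sub>1 / k\<close>.
\<close>

section \<open>Moore--Penrose inverse and full-rank factorization\<close>

text \<open>The columns of \<open>V\<close> form a maximal independent set of columns of
  \<open>A\<close>, so \<open>V\<close> is injective and has \<open>rank A\<close> columns.
  \<open>D\<close> holds the coordinates of the columns of \<open>A\<close> in this basis, and
  \<open>Z\<close> selects the chosen columns. The equation \<open>V = A * Z\<close> is recorded
  because it later yields a right inverse of \<open>D\<close>.\<close>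

lemma full_rank_factorization:
  fixes A :: "real mat"
  assumes A: "A \<in> carrier_mat n d"
  obtains V D Z where "V \<in> carrier_mat n (vec_space.rank n A)"
    and "D \<in> carrier_mat (vec_space.rank n A) d"
    and "Z \<in> carrier_mat d (vec_space.rank n A)"
    and "A = V * D" and "V = A * Z"
    and "\<And>v. v \<in> carrier_vec (vec_space.rank n A) \<Longrightarrow> V *\<^sub>v v = 0\<^sub>v n
           \<Longrightarrow> v = 0\<^sub>v (vec_space.rank n A)"
proof -
  interpret vec_space "TYPE(real)" n .
  let ?r = "rank A"
  let ?P = "\<lambda>T. T \<subseteq> set (cols A) \<and> lin_indpt T"
  have colsA: "set (cols A) \<subseteq> carrier_vec n"
    using cols_dim A by blast
  obtain U where U: "finite U" "maximal U ?P"
    using maximal_exists_superset[of "set (cols A)" ?P "{}"]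
    by (metis (no_types, lifting) List.finite_set empty_subsetI finite.emptyI finite_lin_indpt2 empty_iff)
  have Ui: "lin_indpt U" and Us: "U \<subseteq> set (cols A)"
    using U(2) by (auto simp: maximal_def)
  have Uc: "U \<subseteq> carrier_vec n" using Us colsA by blast
  have r: "?r = card U"
    using rank_card_indpt[OF A U(2)] .
  obtain us where us: "set us = U" "distinct us"
    using finite_distinct_list[OF U(1)] by blast
  have lus: "length us = ?r"
    using us r distinct_card by force
  define V where "V = mat_of_cols n us"
  have V: "V \<in> carrier_mat n ?r"
    using mat_of_cols_carrier(1)[of n us] lus by (simp add: V_def)
  have colsV: "cols V = us"
    unfolding V_def using us Uc by (simp add: cols_mat_of_cols)
  have inj: "v = 0\<^sub>v ?r" if "v \<in> carrier_vec ?r" "V *\<^sub>v v = 0\<^sub>v n" for v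
    using lin_depI[OF V that(1) _ that(2)] us colsV Ui by auto
  have span: "c \<in> span U" if c: "c \<in> set (cols A)" for c
  proof (cases "c \<in> U")
    case True
    then show ?thesis using span_mem[OF Uc] by blast
  next
    case False
    then have "lin_dep (insert c U)"
      using U(2) c Us unfolding maximal_def by blast
    then show ?thesis
      using lin_dep_iff_in_span[OF Uc Ui, of c] c colsA False by auto
  qed
  have "\<exists>w\<in>carrier_vec ?r. V *\<^sub>v w = col A j" if j: "j < d" for j
  proof -
    have "col A j \<in> set (cols A)"
      using j A by (metis carrier_matD(2) cols_length cols_nth nth_mem)
    then have "col A j \<in> span U" by (rule span)
    then obtain a where "lincomb a U = col A j"
      unfolding finite_span[OF U(1) Uc] by auto
    then have "V *\<^sub>v Matrix.vec ?r (\<lambda>i. a (col V i)) = col A j"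
      using mat_mult_eq_lincomb[OF V, of a] colsV us by simp
    then show ?thesis by (metis vec_carrier)
  qed
  then obtain w where w: "\<And>j. j < d \<Longrightarrow> w j \<in> carrier_vec ?r"
      "\<And>j. j < d \<Longrightarrow> V *\<^sub>v w j = col A j"
    by metis
  define D where "D = mat_of_cols ?r (map w [0..<d])"
  have D: "D \<in> carrier_mat ?r d"
    using mat_of_cols_carrier(1)[of ?r "map w [0..<d]"] by (simp add: D_def)
  have colD: "col D j = w j" if "j < d" for j
    unfolding D_def using that w(1) by (subst col_mat_of_cols) auto
  have AVD: "A = V * D"
  proof (rule mat_col_eqI)
    fix j assume "j < dim_col (V * D)"
    then have j: "j < d" using D by simp
    have "col (V * D) j = V *\<^sub>v col D j" using col_mult2[OF V D j] .
    then show "col A j = col (V * D) j" using colD w(2) j by simp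
  qed (use A V D in auto)
  have "\<exists>z\<in>carrier_vec d. A *\<^sub>v z = us ! i" if "i < ?r" for i
  proof -
    have "us ! i \<in> set (cols A)" using that lus us(1) Us nth_mem by fastforce
    then obtain j where j: "j < d" "us ! i = col A j"
      using A by (metis carrier_matD(2) cols_length cols_nth in_set_conv_nth)
    have "A *\<^sub>v unit_vec d j = col A j"
      using A j(1) by (intro eq_vecI) auto
    then show ?thesis using j(2) unit_vec_carrier by metis
  qed
  then obtain z where z: "\<And>i. i < ?r \<Longrightarrow> z i \<in> carrier_vec d"
      "\<And>i. i < ?r \<Longrightarrow> A *\<^sub>v z i = us ! i"
    by metis
  define Z where "Z = mat_of_cols d (map z [0..<?r])"
  have Z: "Z \<in> carrier_mat d ?r"
    using mat_of_cols_carrier(1)[of d "map z [0..<?r]"] by (simp add: Z_def)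
  have VAZ: "V = A * Z"
  proof (rule mat_col_eqI)
    fix i assume "i < dim_col (A * Z)"
    then have i: "i < ?r" using Z by simp
    have "col Z i = z i" unfolding Z_def using i z(1) by (subst col_mat_of_cols) auto
    moreover have "col (A * Z) i = A *\<^sub>v col Z i" using col_mult2[OF A Z i] .
    moreover have "col V i = us ! i"
      using colsV V i by (metis carrier_matD(2) cols_nth)
    ultimately show "col V i = col (A * Z) i" using z(2) i by simp
  qed (use A V Z in auto)
  show thesis using that[OF V D Z AVD VAZ inj] .
qed

text \<open>With dimension equations as premises instead of carrier membership, simp can reassociate
  long products without guessing the inner dimensions.\<close>

lemma mult_mat_assoc_dim:
  fixes A B C :: "real mat"
  assumes "dim_col A = dim_row B" "dim_col B = dim_row C"
  shows "(A * B) * C = A * (B * C)"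
  using assms by (intro assoc_mult_mat[of A "dim_row A" "dim_row B" B "dim_col B" C "dim_col C"]) auto

lemma scalar_prod_self_nonneg: "scalar_prod v v \<ge> (0 :: real)"
  by (auto simp: scalar_prod_def intro: sum_nonneg)

lemma scalar_prod_self_eq_0D:
  fixes v :: "real Matrix.vec"
  assumes "v \<in> carrier_vec n" "scalar_prod v v = 0"
  shows "v = 0\<^sub>v n"
proof (rule eq_vecI)
  fix i assume "i < dim_vec (0\<^sub>v n)"
  then have i: "i \<in> {0..<n}" by simp
  have "(\<Sum>i\<in>{0..<n}. vec_index v i * vec_index v i) = 0"
    using assms by (simp add: scalar_prod_def)
  then have "\<forall>i\<in>{0..<n}. vec_index v i * vec_index v i = 0"
    by (subst (asm) sum_nonneg_eq_0_iff) auto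
  then show "vec_index v i = vec_index (0\<^sub>v n) i" using i by auto
qed (use assms in auto)

text \<open>The witness is \<open>W = H * V^T\<close>, with \<open>H\<close> the inverse of the Gram
  matrix \<open>G = V^T V\<close>. If \<open>G v = 0\<close> then
  \<open>|V v|^2 = <G v, v> = 0\<close>, so injectivity of \<open>V\<close> makes \<open>G\<close>
  nonsingular. Symmetry of \<open>H\<close> makes \<open>V W = V H V^T\<close> symmetric.\<close>

lemma injective_mat_left_inverse:
  fixes V :: "real mat"
  assumes V: "V \<in> carrier_mat n r"
    and inj: "\<And>v. v \<in> carrier_vec r \<Longrightarrow> V *\<^sub>v v = 0\<^sub>v n \<Longrightarrow> v = 0\<^sub>v r"
  obtains W where "W \<in> carrier_mat r n" "W * V = 1\<^sub>m r" "transpose_mat (V * W) = V * W"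
proof -
  let ?t = transpose_mat
  define G where "G = ?t V * V"
  have Vt: "?t V \<in> carrier_mat r n" using V by simp
  have G: "G \<in> carrier_mat r r" using V by (simp add: G_def)
  have Gt: "?t G = G"
    unfolding G_def using V by (simp add: transpose_mult[OF Vt V])
  have "Determinant.det G \<noteq> 0"
  proof
    assume "Determinant.det G = 0"
    then obtain v where v: "v \<in> carrier_vec r" "v \<noteq> 0\<^sub>v r" "G *\<^sub>v v = 0\<^sub>v r"
      using det_0_iff_vec_prod_zero_field[OF G] by auto
    have Vv: "V *\<^sub>v v \<in> carrier_vec n" using V v(1) by simp
    have "scalar_prod (V *\<^sub>v v) (V *\<^sub>v v) = scalar_prod (?t V *\<^sub>v (V *\<^sub>v v)) v"
      using transpose_vec_mult_scalar[OF V v(1) Vv] by simp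
    also have "?t V *\<^sub>v (V *\<^sub>v v) = G *\<^sub>v v"
      unfolding G_def using assoc_mult_mat_vec[OF Vt V v(1)] by simp
    also have "scalar_prod (G *\<^sub>v v) v = 0" using v by simp
    finally have "V *\<^sub>v v = 0\<^sub>v n" using scalar_prod_self_eq_0D[OF Vv] by simp
    then show False using inj v by blast
  qed
  then have "G \<in> Units (ring_mat TYPE(real) r b)" for b
    by (rule det_non_zero_imp_unit[OF G])
  then obtain H where H: "H \<in> carrier_mat r r" and HG: "H * G = 1\<^sub>m r" and GH: "G * H = 1\<^sub>m r"
    unfolding Units_def by (auto simp: ring_mat_def)
  have Ht: "?t H = H"
  proof -
    have "?t H * G = 1\<^sub>m r"
      using transpose_mult[OF G H] GH Gt by simp
    then have "?t H * G * H = H" using H by simp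
    moreover have "?t H * G * H = ?t H * (G * H)"
      using H G by (intro mult_mat_assoc_dim) auto
    ultimately show ?thesis using GH H by simp
  qed
  define W where "W = H * ?t V"
  have W: "W \<in> carrier_mat r n" using H V by (simp add: W_def)
  have WV: "W * V = 1\<^sub>m r"
    unfolding W_def using H V HG by (subst mult_mat_assoc_dim) (auto simp: G_def)
  have "?t (V * W) = ?t W * ?t V" by (rule transpose_mult[OF V W])
  also have "?t W = V * H"
    unfolding W_def by (simp add: transpose_mult[OF H Vt] Ht)
  also have "V * H * ?t V = V * W"
    unfolding W_def using H V by (intro mult_mat_assoc_dim) auto
  finally show thesis using that[OF W WV] by simp
qed

section \<open>The Penrose equations: existence, uniqueness and trace\<close>

definition is_pinv :: "real mat \<Rightarrow> real mat \<Rightarrow> bool" where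
  "is_pinv A B \<longleftrightarrow> B \<in> carrier_mat (dim_col A) (dim_row A) \<and>
      A * B * A = A \<and> B * A * B = B \<and>
      transpose_mat (A * B) = A * B \<and> transpose_mat (B * A) = B * A"

text \<open>The trace is the bridge from rank to Frobenius norm: for an orthogonal projection it
  equals both the rank and the sum of squared entries.\<close>

definition mtrace :: "real mat \<Rightarrow> real" where
  "mtrace A = (\<Sum>i<dim_row A. A $$ (i,i))"

lemma mtrace_mult_commute:
  assumes "A \<in> carrier_mat n m" "B \<in> carrier_mat m n"
  shows "mtrace (A * B) = mtrace (B * A)"
proof -
  have "mtrace (A * B) = (\<Sum>i<n. \<Sum>j<m. A $$ (i,j) * B $$ (j,i))"
    using assms by (auto simp: mtrace_def scalar_prod_def atLeast0LessThan intro!: sum.cong)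
  also have "\<dots> = (\<Sum>j<m. \<Sum>i<n. B $$ (j,i) * A $$ (i,j))"
    by (subst sum.swap) (simp add: mult.commute)
  also have "\<dots> = mtrace (B * A)"
    using assms by (auto simp: mtrace_def scalar_prod_def atLeast0LessThan intro!: sum.cong)
  finally show ?thesis .
qed

text \<open>From \<open>A = V D\<close>, a left inverse \<open>V'\<close> of \<open>V\<close> and a
  right inverse \<open>D'\<close> of \<open>D\<close>, take \<open>B = D' V'\<close>. Then
  \<open>A B = V V'\<close> and \<open>B A = D' D\<close>, both symmetric by the choice of the
  one-sided inverses. The trace is read off the same factorization: that of \<open>D' D\<close> is
  that of \<open>D D' = 1\<close>, of size \<open>r\<close>.\<close>

lemma is_pinv_exists:
  "\<exists>B. is_pinv A B \<and> mtrace (B * A) = real (mrank A)"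
proof -
  let ?t = transpose_mat
  define n d r where "n = dim_row A" and "d = dim_col A" and "r = vec_space.rank n A"
  have A: "A \<in> carrier_mat n d" by (simp add: n_def d_def)
  obtain V D Z where V: "V \<in> carrier_mat n r" and D: "D \<in> carrier_mat r d"
    and Z: "Z \<in> carrier_mat d r" and AVD: "A = V * D" and VAZ: "V = A * Z"
    and inj: "\<And>v. v \<in> carrier_vec r \<Longrightarrow> V *\<^sub>v v = 0\<^sub>v n \<Longrightarrow> v = 0\<^sub>v r"
    using full_rank_factorization[OF A] unfolding r_def by blast
  obtain V' where V': "V' \<in> carrier_mat r n" "V' * V = 1\<^sub>m r" "?t (V * V') = V * V'"
    using injective_mat_left_inverse[OF V inj] by blast
  \<comment> \<open>\<open>V = A Z = V D Z\<close>, and \<open>V\<close> cancels through its left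
    inverse.\<close>
  have DZ: "D * Z = 1\<^sub>m r"
  proof -
    have "V' * V = V' * (V * (D * Z))"
      using VAZ AVD V D Z by (simp add: mult_mat_assoc_dim)
    also have "\<dots> = (V' * V) * (D * Z)"
      using V V' D Z by (intro mult_mat_assoc_dim[symmetric]) auto
    also have "\<dots> = D * Z" using V'(2) D Z by simp
    finally show ?thesis using V'(2) by simp
  qed
  have Dt: "?t D \<in> carrier_mat d r" and Zt: "?t Z \<in> carrier_mat r d"
    using D Z by auto
  \<comment> \<open>\<open>Z^T\<close> is a left inverse of \<open>D^T\<close>, so
    \<open>D^T\<close> is injective; the left inverse with symmetric product obtained for it
    transposes to the right inverse \<open>D'\<close>.\<close>
  have "v = 0\<^sub>v r" if v: "v \<in> carrier_vec r" "?t D *\<^sub>v v = 0\<^sub>v d" for v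
  proof -
    have "?t Z * ?t D = 1\<^sub>m r" using transpose_mult[OF D Z] DZ by simp
    then have "v = (?t Z * ?t D) *\<^sub>v v" using v by simp
    also have "\<dots> = ?t Z *\<^sub>v (?t D *\<^sub>v v)" by (rule assoc_mult_mat_vec[OF Zt Dt v(1)])
    also have "\<dots> = 0\<^sub>v r" using v Zt by (auto intro!: eq_vecI)
    finally show ?thesis .
  qed
  then obtain W where W: "W \<in> carrier_mat r d" "W * ?t D = 1\<^sub>m r"
      "?t (?t D * W) = ?t D * W"
    using injective_mat_left_inverse[OF Dt] by blast
  define D' where "D' = ?t W"
  have D': "D' \<in> carrier_mat d r" using W by (simp add: D'_def)
  have DD': "D * D' = 1\<^sub>m r"
    using transpose_mult[OF W(1) Dt] W(2) by (simp add: D'_def)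
  have D'D: "?t (D' * D) = D' * D"
    using transpose_mult[OF Dt W(1)] W(3) by (simp add: D'_def)
  define B where "B = D' * V'"
  have B: "B \<in> carrier_mat d n" using D' V' by (simp add: B_def)
  have AB: "A * B = V * V'"
  proof -
    have "A * B = V * ((D * D') * V')"
      unfolding AVD B_def using V D D' V'(1) by (simp add: mult_mat_assoc_dim)
    then show ?thesis using DD' V' by (simp del: assoc_mult_mat)
  qed
  have BA: "B * A = D' * D"
  proof -
    have "B * A = D' * ((V' * V) * D)"
      unfolding AVD B_def using V D D' V'(1) by (simp add: mult_mat_assoc_dim)
    then show ?thesis using V' D by (simp del: assoc_mult_mat)
  qed
  have "A * B * A = V * (V' * V) * D"
    unfolding AB unfolding AVD using V D V'(1) by (simp add: mult_mat_assoc_dim)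
  then have 1: "A * B * A = A" using V'(2) V AVD by (simp del: assoc_mult_mat)
  have "B * A * B = D' * (D * D') * V'"
    unfolding BA unfolding B_def using V'(1) D D' by (simp add: mult_mat_assoc_dim)
  then have 2: "B * A * B = B" using DD' D' by (simp add: B_def del: assoc_mult_mat)
  have "mtrace (B * A) = mtrace (1\<^sub>m r)"
    unfolding BA using mtrace_mult_commute[OF D' D] DD' by simp
  also have "\<dots> = real r" by (simp add: mtrace_def)
  finally show ?thesis
    using 1 2 AB BA V'(3) D'D B
    unfolding is_pinv_def mrank_def r_def n_def d_def by (intro exI[of _ B]) auto
qed

text \<open>Symmetry lets the factors be swapped:
  \<open>A B = (A C)(A B) = ((A B)(A C))^T = (A C)^T = A C\<close>, and likewise
  \<open>B A = C A\<close>. Then \<open>B = B A B = C A B = C A C = C\<close>.\<close>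

lemma is_pinv_unique:
  assumes "is_pinv A B" "is_pinv A C"
  shows "B = C"
proof -
  let ?t = transpose_mat
  define n d where "n = dim_row A" and "d = dim_col A"
  have A: "A \<in> carrier_mat n d" by (simp add: n_def d_def)
  have B: "B \<in> carrier_mat d n" "A * B * A = A" "B * A * B = B" "?t (A * B) = A * B" "?t (B * A) = B * A"
    using assms(1) by (auto simp: is_pinv_def n_def d_def)
  have C: "C \<in> carrier_mat d n" "A * C * A = A" "C * A * C = C" "?t (A * C) = A * C" "?t (C * A) = C * A"
    using assms(2) by (auto simp: is_pinv_def n_def d_def)
  have AB: "A * B \<in> carrier_mat n n" and AC: "A * C \<in> carrier_mat n n"
    and BA: "B * A \<in> carrier_mat d d" and CA: "C * A \<in> carrier_mat d d"
    using A B(1) C(1) by auto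
  have "A * C * (A * B) = A * C * A * B"
    using A B(1) C(1) by (simp add: mult_mat_assoc_dim)
  then have "A * B = (A * C) * (A * B)" using C(2) by simp
  also have "\<dots> = ?t ((A * B) * (A * C))"
    using transpose_mult[OF AB AC] B(4) C(4) by simp
  also have "(A * B) * (A * C) = A * B * A * C"
    using A B(1) C(1) by (simp add: mult_mat_assoc_dim)
  finally have eq1: "A * B = A * C" using B(2) C(4) by simp
  have "(B * A) * (C * A) = B * (A * C * A)"
    using A B(1) C(1) by (simp add: mult_mat_assoc_dim)
  then have "B * A = (B * A) * (C * A)" using C(2) by simp
  also have "\<dots> = ?t ((C * A) * (B * A))"
    using transpose_mult[OF CA BA] B(5) C(5) by simp
  also have "(C * A) * (B * A) = C * (A * B * A)"
    using A B(1) C(1) by (simp add: mult_mat_assoc_dim)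
  finally have eq2: "B * A = C * A" using B(2) C(5) by simp
  have "B = C * A * B" using B(3) eq2 by simp
  also have "\<dots> = C * (A * B)" using A B(1) C(1) by (simp add: mult_mat_assoc_dim)
  also have "\<dots> = C * A * C" unfolding eq1 using A C(1) by (simp add: mult_mat_assoc_dim)
  finally show ?thesis using C(3) by simp
qed

lemma pinv_is_pinv: "is_pinv A (pinv A)"
  and mtrace_pinv_mult: "mtrace (pinv A * A) = real (mrank A)"
proof -
  obtain B where B: "is_pinv A B" "mtrace (B * A) = real (mrank A)"
    using is_pinv_exists by blast
  have "pinv A = (THE B. is_pinv A B)"
    by (simp add: pinv_def is_pinv_def)
  then have "pinv A = B"
    using B(1) is_pinv_unique by (metis the_equality)
  then show "is_pinv A (pinv A)" "mtrace (pinv A * A) = real (mrank A)"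
    using B by auto
qed

definition orth_proj :: "nat \<Rightarrow> real mat \<Rightarrow> bool" where
  "orth_proj d R \<longleftrightarrow> R \<in> carrier_mat d d \<and> R * R = R \<and> transpose_mat R = R"

lemma orth_proj_pinv_mult:
  assumes "dim_col A = d"
  shows "orth_proj d (pinv A * A)"
proof -
  have p: "pinv A \<in> carrier_mat d (dim_row A)" "pinv A * A * pinv A = pinv A"
     "transpose_mat (pinv A * A) = pinv A * A"
    using pinv_is_pinv[of A] assms by (auto simp: is_pinv_def)
  have "pinv A * A * (pinv A * A) = pinv A * A * pinv A * A"
    using p(1) assms by (simp add: mult_mat_assoc_dim)
  then show ?thesis using p assms by (auto simp: orth_proj_def)
qed

section \<open>Frobenius norm and orthogonal projections\<close>

definition frob2 :: "real mat \<Rightarrow> real" where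
  "frob2 M = (\<Sum>i<dim_row M. \<Sum>j<dim_col M. (M $$ (i,j))\<^sup>2)"

lemma frob2_nonneg: "frob2 M \<ge> 0"
  by (auto simp: frob2_def intro!: sum_nonneg)

lemma frob2_transpose: "frob2 (transpose_mat M) = frob2 M"
  unfolding frob2_def by (subst sum.swap) simp

lemma frob2_cols: "frob2 M = (\<Sum>j<dim_col M. scalar_prod (col M j) (col M j))"
  unfolding frob2_def
  by (subst sum.swap)
     (auto simp: scalar_prod_def atLeast0LessThan power2_eq_square intro!: sum.cong)

lemma frob2_rows: "frob2 M = (\<Sum>i<dim_row M. scalar_prod (Matrix.row M i) (Matrix.row M i))"
  unfolding frob2_def
  by (auto simp: scalar_prod_def atLeast0LessThan power2_eq_square intro!: sum.cong)

text \<open>Entrywise \<open>(a - b)^2 <= 2 a^2 + 2 b^2\<close>; these factors 2 enter the final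
  constant.\<close>

lemma frob2_minus_le:
  assumes "A \<in> carrier_mat n m" "B \<in> carrier_mat n m"
  shows "frob2 (A - B) \<le> 2 * frob2 A + 2 * frob2 B"
proof -
  have sq: "(a - b)\<^sup>2 \<le> 2 * a\<^sup>2 + 2 * b\<^sup>2" for a b :: real
    using zero_le_power2[of "a + b"] by (simp add: power2_eq_square algebra_simps)
  have "frob2 (A - B) = (\<Sum>i<n. \<Sum>j<m. (A $$ (i,j) - B $$ (i,j))\<^sup>2)"
    using assms by (simp add: frob2_def)
  also have "\<dots> \<le> (\<Sum>i<n. \<Sum>j<m. 2 * (A $$ (i,j))\<^sup>2 + 2 * (B $$ (i,j))\<^sup>2)"
    by (intro sum_mono sq)
  also have "\<dots> = 2 * frob2 A + 2 * frob2 B"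
    using assms by (simp add: frob2_def sum.distrib sum_distrib_left)
  finally show ?thesis .
qed

section \<open>Euclidean, Frobenius and spectral norms\<close>

lemma vnorm_sq: "(vnorm v)\<^sup>2 = scalar_prod v v"
  by (simp add: vnorm_def scalar_prod_self_nonneg)

lemma vnorm_nonneg: "vnorm v \<ge> 0"
  by (simp add: vnorm_def scalar_prod_self_nonneg)

text \<open>Cauchy-Schwarz applied to each row of \<open>M\<close>.\<close>

lemma vnorm_mult_sq_le:
  assumes "v \<in> carrier_vec (dim_col M)"
  shows "(vnorm (M *\<^sub>v v))\<^sup>2 \<le> frob2 M * (vnorm v)\<^sup>2"
proof -
  have "(vnorm (M *\<^sub>v v))\<^sup>2 = (\<Sum>i<dim_row M. (scalar_prod (Matrix.row M i) v)\<^sup>2)"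
    unfolding vnorm_sq by (simp add: scalar_prod_def[of "M *\<^sub>v v"] atLeast0LessThan power2_eq_square)
  also have "\<dots> \<le> (\<Sum>i<dim_row M. scalar_prod (Matrix.row M i) (Matrix.row M i) * scalar_prod v v)"
  proof (rule sum_mono)
    fix i
    have "(\<Sum>j<dim_col M. vec_index (Matrix.row M i) j * vec_index v j)\<^sup>2
        \<le> (\<Sum>j<dim_col M. (vec_index (Matrix.row M i) j)\<^sup>2) * (\<Sum>j<dim_col M. (vec_index v j)\<^sup>2)"
      by (rule Cauchy_Schwarz_ineq_sum)
    then show "(scalar_prod (Matrix.row M i) v)\<^sup>2 \<le> scalar_prod (Matrix.row M i) (Matrix.row M i) * scalar_prod v v"
      using assms by (simp add: scalar_prod_def atLeast0LessThan power2_eq_square)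
  qed
  also have "\<dots> = frob2 M * (vnorm v)\<^sup>2"
    by (simp add: frob2_rows vnorm_sq sum_distrib_right)
  finally show ?thesis .
qed

text \<open>Normalize \<open>v\<close> and compare with the supremum. A vector of norm 0 cannot be
  normalized and is handled by the Frobenius bound.\<close>

lemma vnorm_mult_le_of_spec_norm_le_1:
  assumes spec: "spec_norm A \<le> 1" and v: "v \<in> carrier_vec (dim_col A)"
  shows "vnorm (A *\<^sub>v v) \<le> vnorm v"
proof (cases "vnorm v = 0")
  case True
  then have "(vnorm (A *\<^sub>v v))\<^sup>2 \<le> 0"
    using vnorm_mult_sq_le[OF v] by simp
  then show ?thesis using True by simp
next
  case False
  then have pos: "vnorm v > 0" using vnorm_nonneg[of v] by simp
  define c where "c = 1 / vnorm v"
  have c: "c > 0" using pos by (simp add: c_def)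
  have scale: "vnorm (c \<cdot>\<^sub>v u) = c * vnorm u" for u
    using c by (simp add: vnorm_def scalar_prod_def real_sqrt_mult sum_distrib_left mult_ac
        flip: sum_distrib_left)
  let ?S = "{vnorm (A *\<^sub>v v) | v. v \<in> carrier_vec (dim_col A) \<and> vnorm v \<le> 1}"
  \<comment> \<open>A real \<open>Sup\<close> bounds its elements only if the set is bounded above;
    the Frobenius norm supplies a bound.\<close>
  have bdd: "bdd_above ?S"
  proof (rule bdd_aboveI)
    fix x assume "x \<in> ?S"
    then obtain u where u: "x = vnorm (A *\<^sub>v u)" "u \<in> carrier_vec (dim_col A)" "vnorm u \<le> 1"
      by auto
    have "x\<^sup>2 \<le> frob2 A * (vnorm u)\<^sup>2" using vnorm_mult_sq_le u by simp
    also have "\<dots> \<le> frob2 A * 1"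
      using u(3) vnorm_nonneg[of u] frob2_nonneg[of A]
      by (intro mult_left_mono) (auto simp: power_le_one)
    finally show "x \<le> sqrt (frob2 A)" by (simp add: real_le_rsqrt)
  qed
  have "vnorm (A *\<^sub>v (c \<cdot>\<^sub>v v)) \<le> spec_norm A"
    unfolding spec_norm_def
    by (rule cSup_upper[OF _ bdd]) (use v pos scale in \<open>auto simp: c_def intro!: exI[of _ "c \<cdot>\<^sub>v v"]\<close>)
  also have "A *\<^sub>v (c \<cdot>\<^sub>v v) = c \<cdot>\<^sub>v (A *\<^sub>v v)"
    using v by (intro mult_mat_vec[of A "dim_row A" "dim_col A"]) auto
  finally have "c * vnorm (A *\<^sub>v v) \<le> 1" using scale spec by simp
  then show ?thesis using pos by (simp add: c_def field_simps)
qed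

section \<open>Orthogonal projections and the Frobenius norm\<close>

lemma orth_proj_compl:
  assumes "orth_proj d R"
  shows "orth_proj d (1\<^sub>m d - R)"
proof -
  have R: "R \<in> carrier_mat d d" "R * R = R" "transpose_mat R = R"
    using assms by (auto simp: orth_proj_def)
  have S: "1\<^sub>m d - R \<in> carrier_mat d d" using R by auto
  have "(1\<^sub>m d - R) * (1\<^sub>m d - R) = (1\<^sub>m d - R) - (R - R * R)"
    using R(1) S by (simp add: minus_mult_distrib_mat[OF one_carrier_mat R(1) S]
      mult_minus_distrib_mat[OF R(1) one_carrier_mat R(1)])
  also have "\<dots> = 1\<^sub>m d - R" using R by (intro eq_matI) auto
  finally show ?thesis
    using R S transpose_minus[OF one_carrier_mat R(1)] by (simp add: orth_proj_def)
qed

text \<open>Every orthogonal projection \<open>S\<close> satisfies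
  \<open>|S v|^2 = <S v, v>\<close>. Applying this to \<open>R\<close> and to its complement and
  adding gives \<open><v, v>\<close>.\<close>

lemma orth_proj_pythagoras:
  assumes R: "orth_proj d R" and v: "v \<in> carrier_vec d"
  shows "scalar_prod (R *\<^sub>v v) (R *\<^sub>v v)
       + scalar_prod ((1\<^sub>m d - R) *\<^sub>v v) ((1\<^sub>m d - R) *\<^sub>v v) = scalar_prod v v"
proof -
  have self: "scalar_prod (S *\<^sub>v v) (S *\<^sub>v v) = scalar_prod (S *\<^sub>v v) v" if S: "orth_proj d S" for S
  proof -
    have c: "S \<in> carrier_mat d d" "S * S = S" "transpose_mat S = S"
      using S by (auto simp: orth_proj_def)
    have Sv: "S *\<^sub>v v \<in> carrier_vec d" using c v by simp
    have "scalar_prod (S *\<^sub>v v) (S *\<^sub>v v) = scalar_prod (transpose_mat S *\<^sub>v (S *\<^sub>v v)) v"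
      using transpose_vec_mult_scalar[OF c(1) v Sv] by simp
    also have "transpose_mat S *\<^sub>v (S *\<^sub>v v) = S *\<^sub>v v"
      using assoc_mult_mat_vec[OF c(1) c(1) v] c by simp
    finally show ?thesis .
  qed
  have Rc: "R \<in> carrier_mat d d" using R by (auto simp: orth_proj_def)
  have "(1\<^sub>m d - R) *\<^sub>v v = v - R *\<^sub>v v"
    using minus_mult_distrib_mat_vec[OF one_carrier_mat Rc v] v by simp
  then show ?thesis
    using self[OF R] self[OF orth_proj_compl[OF R]]
      minus_scalar_prod_distrib[of v d "R *\<^sub>v v" v] v Rc by simp
qed

lemma frob2_orth_proj_split:
  assumes R: "orth_proj d R" and M: "M \<in> carrier_mat d m"
  shows "frob2 (R * M) + frob2 ((1\<^sub>m d - R) * M) = frob2 M"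
proof -
  have Rc: "R \<in> carrier_mat d d" using R by (auto simp: orth_proj_def)
  have Sc: "1\<^sub>m d - R \<in> carrier_mat d d" using Rc by auto
  have "frob2 (R * M) + frob2 ((1\<^sub>m d - R) * M) =
     (\<Sum>j<m. scalar_prod (R *\<^sub>v col M j) (R *\<^sub>v col M j)
       + scalar_prod ((1\<^sub>m d - R) *\<^sub>v col M j) ((1\<^sub>m d - R) *\<^sub>v col M j))"
    using M col_mult2[OF Rc M] col_mult2[OF Sc M]
    by (simp add: frob2_cols sum.distrib)
  also have "\<dots> = (\<Sum>j<m. scalar_prod (col M j) (col M j))"
    using M by (intro sum.cong refl orth_proj_pythagoras[OF R]) auto
  finally show ?thesis using M by (simp add: frob2_cols)
qed

lemma frob2_orth_proj_mult_le:
  assumes "orth_proj d R" "M \<in> carrier_mat d m"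
  shows "frob2 (R * M) \<le> frob2 M"
  using frob2_orth_proj_split[OF assms] frob2_nonneg[of "(1\<^sub>m d - R) * M"] by simp

lemma frob2_mult_orth_proj_le:
  assumes R: "orth_proj d R" and M: "M \<in> carrier_mat m d"
  shows "frob2 (M * R) \<le> frob2 M"
proof -
  have Rc: "R \<in> carrier_mat d d" "transpose_mat R = R" using R by (auto simp: orth_proj_def)
  have "frob2 (M * R) = frob2 (transpose_mat (M * R))" by (simp add: frob2_transpose)
  also have "transpose_mat (M * R) = R * transpose_mat M"
    using transpose_mult[OF M Rc(1)] Rc(2) by simp
  also have "frob2 \<dots> \<le> frob2 (transpose_mat M)"
    using M by (intro frob2_orth_proj_mult_le[OF R, of _ m]) auto
  finally show ?thesis by (simp add: frob2_transpose)
qed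

text \<open>By symmetry the diagonal entries of \<open>R * R\<close> are the squared row norms, and
  \<open>R * R = R\<close>.\<close>

lemma frob2_orth_proj:
  assumes "orth_proj d R"
  shows "frob2 R = mtrace R"
proof -
  have R: "R \<in> carrier_mat d d" "R * R = R" "transpose_mat R = R"
    using assms by (auto simp: orth_proj_def)
  have "col R i = Matrix.row R i" if "i < d" for i
    using R that by (metis carrier_matD(1) col_transpose)
  then have "mtrace (R * R) = frob2 R"
    using R(1) by (auto simp: mtrace_def frob2_rows)
  then show ?thesis using R(2) by simp
qed

section \<open>Random products of projections\<close>

text \<open>Coordinates of an i.i.d. family read along any distinct indices form an i.i.d. list,
  whatever the indices and their order. This exchangeability lets different index lists share one
  product space. In the induction, distinctness keeps the value drawn at \<open>j\<close> from
  affecting the tail.\<close>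

lemma map_pmf_Pi_pmf_distinct_list:
  assumes "distinct js" "set js \<subseteq> A" "finite A"
  shows "map_pmf (\<lambda>f. map f js) (Pi_pmf A c (\<lambda>_. p)) = replicate_pmf (length js) p"
  using assms
proof (induction js arbitrary: A)
  case Nil
  then show ?case by (simp add: map_pmf_const)
next
  case (Cons j js)
  have A: "A = insert j (A - {j})" using Cons.prems by auto
  have eq: "map (f(j := y)) (j # js) = y # map f js" for f :: "'a \<Rightarrow> 'b" and y
    using Cons.prems(1) by auto
  have IH: "map_pmf (\<lambda>f. map f js) (Pi_pmf (A - {j}) c (\<lambda>_. p)) = replicate_pmf (length js) p"
    using Cons.prems by (intro Cons.IH) auto
  have "Pi_pmf A c (\<lambda>_. p) =
      bind_pmf p (\<lambda>y. bind_pmf (Pi_pmf (A - {j}) c (\<lambda>_. p)) (\<lambda>f. return_pmf (f(j := y))))"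
    by (subst A, rule Pi_pmf_insert') (use Cons.prems in auto)
  then have "map_pmf (\<lambda>f. map f (j # js)) (Pi_pmf A c (\<lambda>_. p)) =
      bind_pmf p (\<lambda>y. map_pmf ((#) y) (map_pmf (\<lambda>f. map f js) (Pi_pmf (A - {j}) c (\<lambda>_. p))))"
    by (simp add: map_bind_pmf map_pmf_def[symmetric] pmf.map_comp o_def eq del: list.map)
  also have "\<dots> = replicate_pmf (length (j # js)) p"
    unfolding IH by (simp add: map_pmf_def)
  finally show ?case .
qed

lemma expectation_Pi_pmf_distinct_list:
  fixes g :: "'b list \<Rightarrow> real"
  assumes "distinct js" "set js \<subseteq> A" "finite A"
  shows "measure_pmf.expectation (Pi_pmf A c (\<lambda>_. p)) (\<lambda>f. g (map f js)) =
    measure_pmf.expectation (replicate_pmf (length js) p) g"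
  unfolding map_pmf_Pi_pmf_distinct_list[OF assms, of c p, symmetric] by simp

locale random_projections =
  fixes d :: nat and R :: "nat \<Rightarrow> real mat" and p :: "nat pmf"
  assumes proj: "orth_proj d (R m)" and fin: "finite (set_pmf p)"
begin

text \<open>The head of the list is the leftmost factor, that is, the step applied last; orderings
  therefore enter reversed.\<close>

primrec prodP :: "nat list \<Rightarrow> real mat" where
  "prodP [] = 1\<^sub>m d"
| "prodP (x # xs) = (1\<^sub>m d - R x) * prodP xs"

text \<open>The head is the index tested, the tail the projections applied before. The value at
  \<open>[]\<close> is a filler.\<close>

primrec residual :: "nat list \<Rightarrow> real" where
  "residual [] = 0"
| "residual (x # xs) = frob2 (R x * prodP xs)"

definition mean_frob2 :: "nat \<Rightarrow> real" where
  "mean_frob2 n = measure_pmf.expectation (replicate_pmf n p) (\<lambda>xs. frob2 (prodP xs))"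

text \<open>\<open>Suc n\<close> draws: one for the tested index and \<open>n\<close> for the
  projections, so the filler value of \<open>residual\<close> never occurs.\<close>

definition mean_residual :: "nat \<Rightarrow> real" where
  "mean_residual n = measure_pmf.expectation (replicate_pmf (Suc n) p) residual"

lemma R_carrier [simp]: "R m \<in> carrier_mat d d"
  and R_dims [simp]: "dim_row (R m) = d" "dim_col (R m) = d"
  using proj[of m] by (auto simp: orth_proj_def)

lemma prodP_carrier [simp]: "prodP xs \<in> carrier_mat d d"
  by (induction xs) (auto simp: minus_carrier_mat)

lemma prodP_dims [simp]: "dim_row (prodP xs) = d" "dim_col (prodP xs) = d"
  using carrier_matD[OF prodP_carrier] by auto

lemma prodP_append: "prodP (xs @ ys) = prodP xs * prodP ys"
  by (induction xs) (simp_all add: mult_mat_assoc_dim)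

lemma frob2_mult_prodP_le: "M \<in> carrier_mat n d \<Longrightarrow> frob2 (M * prodP xs) \<le> frob2 M"
proof (induction xs arbitrary: M)
  case (Cons x xs)
  have "M * prodP (x # xs) = M * (1\<^sub>m d - R x) * prodP xs"
    using Cons.prems by (simp add: mult_mat_assoc_dim)
  also have "frob2 \<dots> \<le> frob2 (M * (1\<^sub>m d - R x))"
    using Cons.prems by (intro Cons.IH) (auto simp: minus_carrier_mat)
  also have "\<dots> \<le> frob2 M"
    using Cons.prems proj by (intro frob2_mult_orth_proj_le[of d] orth_proj_compl) auto
  finally show ?case .
qed simp

lemma frob2_prodP_mult_le:
  assumes "M \<in> carrier_mat d n" shows "frob2 (prodP xs * M) \<le> frob2 M"
proof (induction xs)
  case (Cons x xs)
  have "prodP (x # xs) * M = (1\<^sub>m d - R x) * (prodP xs * M)"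
    using assms by (simp add: mult_mat_assoc_dim)
  also have "frob2 \<dots> \<le> frob2 (prodP xs * M)"
    using assms proj by (intro frob2_orth_proj_mult_le[of d _ _ n] orth_proj_compl) auto
  also note Cons.IH
  finally show ?case .
qed (use assms in simp)

lemma residual_eq: "residual (x # xs) = frob2 (prodP xs) - frob2 (prodP (x # xs))"
  using frob2_orth_proj_split[OF proj prodP_carrier, of x xs] by simp

text \<open>A new last entry multiplies by a projection from the right, which is a contraction.
  Nonemptiness matters, since \<open>residual []\<close> is 0 while \<open>residual [y]\<close> need
  not be.\<close>

lemma residual_snoc_le: "xs \<noteq> [] \<Longrightarrow> residual (xs @ [y]) \<le> residual xs"
proof (cases xs)
  case (Cons x ys)
  have "frob2 (R x * prodP (ys @ [y])) = frob2 (R x * prodP ys * prodP [y])"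
    by (simp only: prodP_append) (simp add: mult_mat_assoc_dim)
  also have "\<dots> \<le> frob2 (R x * prodP ys)"
    by (rule frob2_mult_prodP_le) auto
  finally show ?thesis using Cons by simp
qed simp

lemma integrable_Pi_pmf [simp]:
  fixes g :: "('i \<Rightarrow> nat) \<Rightarrow> real"
  assumes "finite A"
  shows "integrable (measure_pmf (Pi_pmf A c (\<lambda>_. p))) g"
  using assms fin by (intro integrable_measure_pmf_finite) (auto simp: set_Pi_pmf)

lemma mean_residual_eq: "mean_residual n = mean_frob2 n - mean_frob2 (Suc n)"
proof -
  \<comment> \<open>Both product lengths are realized on one space of \<open>n + 1\<close>
    coordinates, so that \<open>residual_eq\<close> applies pointwise; \<open>?m\<close> omits
    coordinate 0, the tested index.\<close>
  let ?P = "Pi_pmf {0..<Suc n} 0 (\<lambda>_. p)" and ?E = "measure_pmf.expectation"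
  let ?l = "[0..<Suc n]" and ?m = "[1..<Suc n]"
  have l: "?l = 0 # ?m" by (simp add: upt_conv_Cons del: upt_Suc)
  have "mean_residual n = ?E ?P (\<lambda>f. residual (map f ?l))"
    unfolding mean_residual_def by (subst expectation_Pi_pmf_distinct_list) (auto simp del: upt_Suc)
  also have "\<dots> = ?E ?P (\<lambda>f. frob2 (prodP (map f ?m)) - frob2 (prodP (map f ?l)))"
    unfolding l by (simp add: residual_eq del: residual.simps prodP.simps upt_Suc)
  also have "\<dots> = ?E ?P (\<lambda>f. frob2 (prodP (map f ?m))) - ?E ?P (\<lambda>f. frob2 (prodP (map f ?l)))"
    by (rule Bochner_Integration.integral_diff) auto
  also have "?E ?P (\<lambda>f. frob2 (prodP (map f ?m))) = mean_frob2 n"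
    unfolding mean_frob2_def by (subst expectation_Pi_pmf_distinct_list) (auto simp del: upt_Suc)
  also have "?E ?P (\<lambda>f. frob2 (prodP (map f ?l))) = mean_frob2 (Suc n)"
    unfolding mean_frob2_def by (subst expectation_Pi_pmf_distinct_list) (auto simp del: upt_Suc)
  finally show ?thesis .
qed

lemma mean_residual_Suc_le: "mean_residual (Suc n) \<le> mean_residual n"
proof -
  let ?P = "Pi_pmf {0..<Suc (Suc n)} 0 (\<lambda>_. p)" and ?E = "measure_pmf.expectation"
  have "mean_residual (Suc n) = ?E ?P (\<lambda>f. residual (map f [0..<Suc (Suc n)]))"
    unfolding mean_residual_def by (subst expectation_Pi_pmf_distinct_list) auto
  also have "\<dots> \<le> ?E ?P (\<lambda>f. residual (map f [0..<Suc n]))"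
  proof (rule integral_mono)
    fix f :: "nat \<Rightarrow> nat"
    have "map f [0..<Suc (Suc n)] = map f [0..<Suc n] @ [f (Suc n)]" by simp
    then show "residual (map f [0..<Suc (Suc n)]) \<le> residual (map f [0..<Suc n])"
      using residual_snoc_le[of "map f [0..<Suc n]" "f (Suc n)"] by simp
  qed auto
  also have "\<dots> = mean_residual n"
    unfolding mean_residual_def by (subst expectation_Pi_pmf_distinct_list) auto
  finally show ?thesis .
qed

lemma mean_frob2_nonneg: "mean_frob2 n \<ge> 0"
  unfolding mean_frob2_def by (intro integral_nonneg_AE) (simp add: frob2_nonneg)

lemma mean_residual_le:
  assumes "n \<ge> 1"
  shows "mean_residual n \<le> mean_frob2 1 / real n"
proof -
  have anti: "mean_residual n \<le> mean_residual j" if "j \<le> n" for j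
    using lift_Suc_antimono_le[of mean_residual, OF mean_residual_Suc_le that] .
  \<comment> \<open>Starting the sum at 1 rather than 0 leaves \<open>mean_frob2 1\<close> after
    telescoping instead of \<open>mean_frob2 0\<close>, which is \<open>d\<close>.\<close>
  have "real n * mean_residual n = (\<Sum>j=1..n. mean_residual n)" by simp
  also have "\<dots> \<le> (\<Sum>j=1..n. mean_residual j)"
    by (intro sum_mono anti) auto
  also have "\<dots> = mean_frob2 1 - mean_frob2 (Suc n)"
    by (induction n) (simp_all add: mean_residual_eq)
  also have "\<dots> \<le> mean_frob2 1" using mean_frob2_nonneg[of "Suc n"] by simp
  finally show ?thesis using assms by (simp add: field_simps)
qed

lemma mean_frob2_1: "mean_frob2 1 = measure_pmf.expectation p (\<lambda>x. frob2 (1\<^sub>m d - R x))"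
proof -
  have "(1\<^sub>m d - R x) * 1\<^sub>m d = 1\<^sub>m d - R x" for x
    by (intro right_mult_one_mat) (auto simp: minus_carrier_mat)
  then show ?thesis
    unfolding mean_frob2_def replicate_pmf_1 by simp
qed

text \<open>In the correction term \<open>?B\<close>, either the factors right of
  \<open>R x * prodP us\<close> or those left of \<open>R x * prodP vs\<close> can be stripped as
  contractions. Leaving \<open>ws\<close> open lets the caller keep the longer side.\<close>

lemma frob2_residual_inner_le:
  assumes "ws = us \<or> ws = vs"
  shows "frob2 (R x * prodP (us @ x # vs)) \<le> 2 * residual (x # us @ vs) + 2 * residual (x # ws)"
proof -
  let ?A = "R x * prodP us * prodP vs" and ?B = "R x * prodP us * (R x * prodP vs)"
  have A: "R x * prodP us \<in> carrier_mat d d" by (simp add: mult_carrier_mat[of _ d d])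
  have C: "R x * prodP vs \<in> carrier_mat d d" by (simp add: mult_carrier_mat[of _ d d])
  have "prodP (x # vs) = prodP vs - R x * prodP vs"
    by (simp add: minus_mult_distrib_mat[OF one_carrier_mat R_carrier prodP_carrier])
  then have "R x * prodP (us @ x # vs) = R x * prodP us * (prodP vs - R x * prodP vs)"
    by (simp add: prodP_append mult_mat_assoc_dim del: prodP.simps)
  also have "\<dots> = ?A - ?B"
    by (rule mult_minus_distrib_mat[OF A prodP_carrier C])
  finally have "frob2 (R x * prodP (us @ x # vs)) \<le> 2 * frob2 ?A + 2 * frob2 ?B"
    using frob2_minus_le[of ?A d d ?B] A C by (simp add: mult_carrier_mat[of _ d d])
  moreover have "frob2 ?A = residual (x # us @ vs)"
    by (simp add: prodP_append mult_mat_assoc_dim)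
  moreover have "frob2 ?B \<le> residual (x # ws)"
  proof (cases "ws = us")
    case True
    have "frob2 ?B = frob2 (R x * prodP us * R x * prodP vs)"
      by (simp add: mult_mat_assoc_dim)
    also have "\<dots> \<le> frob2 (R x * prodP us * R x)"
      by (rule frob2_mult_prodP_le[of _ d]) (simp add: mult_carrier_mat[of _ d d])
    also have "\<dots> \<le> frob2 (R x * prodP us)"
      by (rule frob2_mult_orth_proj_le[OF proj A])
    finally show ?thesis using True by simp
  next
    case False
    then have ws: "ws = vs" using assms by simp
    have "frob2 ?B = frob2 (R x * (prodP us * (R x * prodP vs)))"
      by (simp add: mult_mat_assoc_dim)
    also have "\<dots> \<le> frob2 (prodP us * (R x * prodP vs))"
      using C by (intro frob2_orth_proj_mult_le[OF proj, of _ d]) (simp add: mult_carrier_mat[of _ d d])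
    also have "\<dots> \<le> frob2 (R x * prodP vs)"
      by (rule frob2_prodP_mult_le[OF C])
    finally show ?thesis using ws by simp
  qed
  ultimately show ?thesis by linarith
qed

lemma expected_inner_residual_le:
  assumes t: "1 \<le> t" "t < k"
  shows "measure_pmf.expectation (Pi_pmf {1..k} c (\<lambda>_. p))
      (\<lambda>f. frob2 (R (f t) * prodP (map f (rev [1..<Suc k])))) \<le> 6 * mean_frob2 1 / real (k - 1)"
proof -
  let ?P = "Pi_pmf {1..k} c (\<lambda>_. p)" and ?E = "measure_pmf.expectation"
  define us vs where "us = rev [Suc t..<Suc k]" and "vs = rev [1..<t]"
  \<comment> \<open>The lengths \<open>k - t\<close> of \<open>us\<close> and \<open>t - 1\<close>
    of \<open>vs\<close> sum to \<open>k - 1\<close>; \<open>ws\<close> has at least half of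
    that.\<close>
  define ws where "ws = (if k - 1 \<le> 2 * (k - t) then us else vs)"
  have "[1..<Suc k] = [1..<t] @ t # [Suc t..<Suc k]"
    using t upt_add_eq_append[of 1 t "Suc k - t"] upt_conv_Cons[of t "Suc k"] by simp
  then have split: "rev [1..<Suc k] = us @ t # vs" by (simp add: us_def vs_def)
  have len: "length ws \<ge> 1" "k - 1 \<le> 2 * length ws" "length (us @ vs) = k - 1"
    using t by (auto simp: ws_def us_def vs_def)
  have dist: "distinct (t # us @ vs)" "distinct (t # ws)"
    by (auto simp: ws_def us_def vs_def)
  have sub: "set (t # us @ vs) \<subseteq> {1..k}" "set (t # ws) \<subseteq> {1..k}"
    using t by (auto simp: ws_def us_def vs_def)
  have "?E ?P (\<lambda>f. frob2 (R (f t) * prodP (map f (rev [1..<Suc k]))))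
      \<le> ?E ?P (\<lambda>f. 2 * residual (map f (t # us @ vs)) + 2 * residual (map f (t # ws)))"
  proof (rule integral_mono)
    fix f :: "nat \<Rightarrow> nat"
    show "frob2 (R (f t) * prodP (map f (rev [1..<Suc k])))
        \<le> 2 * residual (map f (t # us @ vs)) + 2 * residual (map f (t # ws))"
      unfolding split
      using frob2_residual_inner_le[of "map f ws" "map f us" "map f vs" "f t"]
      by (auto simp: ws_def)
  qed auto
  also have "\<dots> = 2 * ?E ?P (\<lambda>f. residual (map f (t # us @ vs))) + 2 * ?E ?P (\<lambda>f. residual (map f (t # ws)))"
    by (subst Bochner_Integration.integral_add) auto
  also have "?E ?P (\<lambda>f. residual (map f (t # us @ vs))) = mean_residual (k - 1)"
    unfolding expectation_Pi_pmf_distinct_list[OF dist(1) sub(1) finite_atLeastAtMost] mean_residual_def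
    using len(3) by simp
  also have "?E ?P (\<lambda>f. residual (map f (t # ws))) = mean_residual (length ws)"
    unfolding expectation_Pi_pmf_distinct_list[OF dist(2) sub(2) finite_atLeastAtMost] mean_residual_def
    by simp
  \<comment> \<open>The first term contributes 2, the second 2 * 2 because \<open>length ws\<close>
    is at least \<open>(k - 1) / 2\<close>; hence the 6.\<close>
  also have "2 * mean_residual (k - 1) + 2 * mean_residual (length ws)
      \<le> 2 * (mean_frob2 1 / real (k - 1)) + 2 * (mean_frob2 1 * 2 / real (k - 1))"
  proof (intro add_mono mult_left_mono)
    show "mean_residual (k - 1) \<le> mean_frob2 1 / real (k - 1)"
      using t by (intro mean_residual_le) auto
    have "mean_residual (length ws) \<le> mean_frob2 1 / real (length ws)"
      using len by (intro mean_residual_le)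
    also have "\<dots> \<le> mean_frob2 1 / (real (k - 1) / 2)"
      using len t mean_frob2_nonneg[of 1] by (intro divide_left_mono mult_pos_pos) auto
    finally show "mean_residual (length ws) \<le> mean_frob2 1 * 2 / real (k - 1)" by simp
  qed auto
  finally show ?thesis by simp
qed

lemma expected_residual_sum_le:
  assumes k: "k \<ge> 2"
  shows "measure_pmf.expectation (Pi_pmf {1..k} c (\<lambda>_. p))
      (\<lambda>f. \<Sum>t=1..k. frob2 (R (f t) * prodP (map f (rev [1..<Suc k])))) \<le> 6 * mean_frob2 1"
proof -
  let ?P = "Pi_pmf {1..k} c (\<lambda>_. p)" and ?E = "measure_pmf.expectation"
  let ?F = "\<lambda>t f. frob2 (R (f t) * prodP (map f (rev [1..<Suc k])))"
  \<comment> \<open>The leftmost factor of the product is the complement of \<open>R (f k)\<close>,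
    which \<open>R (f k)\<close> annihilates.\<close>
  have last: "?F k f = 0" for f
  proof -
    have RR: "R (f k) * R (f k) = R (f k)" using proj[of "f k"] by (simp add: orth_proj_def)
    have "rev [1..<Suc k] = k # rev [1..<k]" using k by simp
    then have "R (f k) * prodP (map f (rev [1..<Suc k]))
        = R (f k) * (1\<^sub>m d - R (f k)) * prodP (map f (rev [1..<k]))"
      by (simp add: mult_mat_assoc_dim)
    also have "R (f k) * (1\<^sub>m d - R (f k)) = 0\<^sub>m d d"
      using mult_minus_distrib_mat[OF R_carrier one_carrier_mat R_carrier, of "f k" "f k"] RR
      by (simp add: right_mult_one_mat[OF R_carrier] minus_r_inv_mat[OF R_carrier])
    finally show ?thesis by (simp add: left_mult_zero_mat[OF prodP_carrier] frob2_def)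
  qed
  \<comment> \<open>Dropping \<open>t = k\<close> leaves \<open>k - 1\<close> summands, which cancel
    the denominator \<open>k - 1\<close> of the bound on each.\<close>
  have ivl: "{1..k} = insert k {1..k - 1}" using k by auto
  have "?E ?P (\<lambda>f. \<Sum>t=1..k. ?F t f) = (\<Sum>t=1..k. ?E ?P (?F t))"
    by (rule Bochner_Integration.integral_sum) auto
  also have "\<dots> = (\<Sum>t=1..k-1. ?E ?P (?F t))"
    using k last by (subst ivl) (subst sum.insert, auto)
  also have "\<dots> \<le> (\<Sum>t=1..k-1. 6 * mean_frob2 1 / real (k - 1))"
    by (intro sum_mono expected_inner_residual_le) (use k in auto)
  also have "\<dots> = 6 * mean_frob2 1" using k by simp
  finally show ?thesis .
qed

end

section \<open>From the iterates to products of projections, and the final bound\<close>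

lemma mtrace_one_minus:
  "R \<in> carrier_mat d d \<Longrightarrow> mtrace (1\<^sub>m d - R) = real d - mtrace R"
  by (simp add: mtrace_def sum_subtractf)

theorem mainTheorem7:
  fixes d T k :: nat and X :: "nat \<Rightarrow> real mat" and y :: "nat \<Rightarrow> real Matrix.vec"
  assumes "d \<ge> 1" and "T \<ge> 1" and "in_S d T X y" and "k \<ge> 2"
  shows "measure_pmf.expectation (ordering_law T k) (\<lambda>tau. forgetting d X y tau k)
           \<le> 9 * (real d - (\<Sum>m=1..T. real (mrank (X m))) / real T) / real k"
proof -
  let ?E = "measure_pmf.expectation"
  \<comment> \<open>The default 0 is an orthogonal projection, so the locale assumption holds for
    every index.\<close>
  define R where "R m = (if m \<in> {1..T} then pinv (X m) * X m else 0\<^sub>m d d)" for m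
  define p where "p = pmf_of_set {1..T}"
  have setp: "set_pmf p = {1..T}" unfolding p_def using assms(2) by (intro set_pmf_of_set) auto
  obtain w where w: "w \<in> carrier_vec d" "vnorm w \<le> 1" and y: "\<And>m. m \<in> {1..T} \<Longrightarrow> y m = X m *\<^sub>v w"
    using assms(3) by (auto simp: in_S_def)
  have X: "X m \<in> carrier_mat (dim_row (X m)) d" "spec_norm (X m) \<le> 1" "dim_col (X m) = d"
    if "m \<in> {1..T}" for m
    using assms(3) that by (auto simp: in_S_def)
  have B: "pinv (X m) \<in> carrier_mat d (dim_row (X m))" "X m * pinv (X m) * X m = X m"
    if "m \<in> {1..T}" for m
    using pinv_is_pinv[of "X m"] X(3)[OF that] by (auto simp: is_pinv_def)
  interpret random_projections d R p
  proof
    show "orth_proj d (R m)" for m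
      using orth_proj_pinv_mult[OF X(3)] by (auto simp: R_def orth_proj_def)
    show "finite (set_pmf p)" by (simp add: setp)
  qed
  \<comment> \<open>The error \<open>w - w_t\<close> is multiplied on the left by
    \<open>1 - R\<close> at each step, because the task is consistent with \<open>w\<close>.\<close>
  have it: "iterate d X y f t = w - prodP (map f (rev [1..<Suc t])) *\<^sub>v w"
    if "\<And>s. s \<in> {1..t} \<Longrightarrow> f s \<in> {1..T}" for f t
    using that
  proof (induction t)
    case 0
    then show ?case using w by simp
  next
    case (Suc t)
    define q where "q = prodP (map f (rev [1..<Suc t])) *\<^sub>v w"
    define m where "m = f (Suc t)"
    have m: "m \<in> {1..T}" using Suc.prems[of "Suc t"] by (simp add: m_def)
    have q: "q \<in> carrier_vec d" unfolding q_def by (rule mult_mat_vec_carrier[OF prodP_carrier w(1)])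
    have IH: "iterate d X y f t = w - q"
      unfolding q_def using Suc.prems by (intro Suc.IH) auto
    have "X m *\<^sub>v w - X m *\<^sub>v (w - q) = X m *\<^sub>v q"
      unfolding mult_minus_distrib_mat_vec[OF X(1)[OF m] w(1) q]
      by (intro eq_vecI) auto
    then have "iterate d X y f (Suc t) = (w - q) + pinv (X m) *\<^sub>v (X m *\<^sub>v q)"
      using y[OF m] IH by (simp add: m_def)
    also have "pinv (X m) *\<^sub>v (X m *\<^sub>v q) = R m *\<^sub>v q"
      using m assoc_mult_mat_vec[OF B(1)[OF m] X(1)[OF m] q] by (simp add: R_def)
    also have "(w - q) + R m *\<^sub>v q = w - (1\<^sub>m d - R m) *\<^sub>v q"
      unfolding minus_mult_distrib_mat_vec[OF one_carrier_mat R_carrier q]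
      using w q R_carrier[of m] by (intro eq_vecI) auto
    also have "(1\<^sub>m d - R m) *\<^sub>v q = prodP (map f (rev [1..<Suc (Suc t)])) *\<^sub>v w"
    proof -
      have "1\<^sub>m d - R m \<in> carrier_mat d d" by (simp add: minus_carrier_mat)
      then show ?thesis
        unfolding q_def using assoc_mult_mat_vec[OF _ prodP_carrier w(1)] by (simp add: m_def)
    qed
    finally show ?case .
  qed
  have forget: "forgetting d X y f k
      \<le> (1 / real k) * (\<Sum>t=1..k. frob2 (R (f t) * prodP (map f (rev [1..<Suc k]))))"
    if f: "\<And>s. s \<in> {1..k} \<Longrightarrow> f s \<in> {1..T}" for f
    unfolding forgetting_def
  proof (intro mult_left_mono sum_mono)
    fix t assume t: "t \<in> {1..k}"
    define m Q where "m = f t" and "Q = prodP (map f (rev [1..<Suc k]))"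
    define q where "q = Q *\<^sub>v w"
    have m: "m \<in> {1..T}" using f[OF t] by (simp add: m_def)
    have q: "q \<in> carrier_vec d" unfolding q_def Q_def by (rule mult_mat_vec_carrier[OF prodP_carrier w(1)])
    have Rq: "R m *\<^sub>v q \<in> carrier_vec d" using q by (simp add: mult_mat_vec_carrier[of _ d d])
    have itk: "iterate d X y f k = w - q"
      unfolding q_def Q_def by (rule it) (rule f)
    have "X m *\<^sub>v iterate d X y f k - y m = X m *\<^sub>v (w - q) - X m *\<^sub>v w"
      unfolding itk y[OF m] ..
    also have "\<dots> = - (X m *\<^sub>v q)"
      unfolding mult_minus_distrib_mat_vec[OF X(1)[OF m] w(1) q]
      by (intro eq_vecI) auto
    also have "vnorm \<dots> = vnorm (X m *\<^sub>v q)"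
      by (simp add: vnorm_def)
    \<comment> \<open>\<open>X X^+ X = X\<close> allows \<open>R m\<close> to be inserted; the
      spectral norm bound then removes \<open>X m\<close>.\<close>
    also have "X m *\<^sub>v q = X m *\<^sub>v (R m *\<^sub>v q)"
    proof -
      have "X m * R m = X m"
        using m B(1)[OF m] B(2)[OF m] X(3)[OF m] by (simp add: R_def flip: mult_mat_assoc_dim)
      then show ?thesis
        using assoc_mult_mat_vec[OF X(1)[OF m] R_carrier q] by metis
    qed
    also have "vnorm \<dots> \<le> vnorm (R m *\<^sub>v q)"
      using vnorm_mult_le_of_spec_norm_le_1[OF X(2)[OF m]] Rq X(3)[OF m] by simp
    finally have "(vnorm (X m *\<^sub>v iterate d X y f k - y m))\<^sup>2 \<le> (vnorm (R m *\<^sub>v q))\<^sup>2"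
      by (simp add: vnorm_nonneg power_mono)
    also have "R m *\<^sub>v q = (R m * Q) *\<^sub>v w"
      unfolding q_def Q_def by (rule assoc_mult_mat_vec[OF R_carrier prodP_carrier w(1), symmetric])
    \<comment> \<open>Passing to the Frobenius norm separates the random product from
      \<open>w\<close>, which then disappears through \<open>vnorm w <= 1\<close>.\<close>
    also have "(vnorm \<dots>)\<^sup>2 \<le> frob2 (R m * Q) * (vnorm w)\<^sup>2"
      by (rule vnorm_mult_sq_le) (use w in \<open>simp add: Q_def\<close>)
    also have "\<dots> \<le> frob2 (R m * Q) * 1"
      using w vnorm_nonneg[of w] by (intro mult_left_mono frob2_nonneg) (auto simp: power_le_one)
    finally show "(vnorm (X (f t) *\<^sub>v iterate d X y f k - y (f t)))\<^sup>2
        \<le> frob2 (R (f t) * prodP (map f (rev [1..<Suc k])))"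
      by (simp add: m_def Q_def)
  qed simp
  have law: "ordering_law T k = Pi_pmf {1..k} 1 (\<lambda>_. p)" by (simp add: ordering_law_def p_def)
  have "?E (ordering_law T k) (\<lambda>f. forgetting d X y f k)
      \<le> ?E (ordering_law T k)
          (\<lambda>f. (1 / real k) * (\<Sum>t=1..k. frob2 (R (f t) * prodP (map f (rev [1..<Suc k])))))"
    unfolding law
  \<comment> \<open>The pointwise bound needs indices in \<open>{1..T}\<close>, which is guaranteed
    only on the support of the law.\<close>
  proof (rule integral_mono_AE)
    show "AE f in measure_pmf (Pi_pmf {1..k} 1 (\<lambda>_. p)). forgetting d X y f k
      \<le> (1 / real k) * (\<Sum>t=1..k. frob2 (R (f t) * prodP (map f (rev [1..<Suc k]))))"
      by (intro AE_pmfI forget) (auto simp: set_Pi_pmf PiE_dflt_def setp)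
  qed auto
  also have "\<dots> \<le> (1 / real k) * (6 * mean_frob2 1)"
    unfolding law integral_mult_right_zero
    using expected_residual_sum_le[OF assms(4), of 1] by (intro mult_left_mono) auto
  \<comment> \<open>The constant 6 is relaxed to the claimed 9, using that
    \<open>mean_frob2 1\<close> is nonnegative.\<close>
  also have "\<dots> \<le> 9 * mean_frob2 1 / real k"
    using mean_frob2_nonneg[of 1] assms(4) by (simp add: field_simps)
  also have "mean_frob2 1 = (\<Sum>m=1..T. frob2 (1\<^sub>m d - R m)) / real T"
    unfolding mean_frob2_1 unfolding p_def using assms(2) by (subst integral_pmf_of_set) auto
  also have "(\<Sum>m=1..T. frob2 (1\<^sub>m d - R m)) = (\<Sum>m=1..T. real d - real (mrank (X m)))"
  proof (rule sum.cong)
    fix m assume m: "m \<in> {1..T}"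
    have "frob2 (1\<^sub>m d - R m) = real d - mtrace (R m)"
      using frob2_orth_proj[OF orth_proj_compl[OF proj]] mtrace_one_minus[OF R_carrier] by simp
    then show "frob2 (1\<^sub>m d - R m) = real d - real (mrank (X m))"
      using m mtrace_pinv_mult[of "X m"] by (simp add: R_def)
  qed simp
  also have "\<dots> / real T = real d - (\<Sum>m=1..T. real (mrank (X m))) / real T"
    using assms(2) by (simp add: sum_subtractf field_simps)
  finally show ?thesis by simp
qed

end
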